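(* Let $n\ge 1$ and $0\le m_1\le n-1$ be integers, and let $K_{n,2,m_1}$ be the welded knot obtained from the standard diagram of the torus knot $K(2,2n+1)$ by welding two crossings that separate the remaining $2n-1$ classical crossings into two groups of $m_1$ and $m_2=2n-1-m_1$ consecutive crossings. Then $$G(K_{n,2,m_1})\cong\mathbb{Z}\quad\text{when } m_1=n-1,$$ $$G(K_{n,2,m_1})\not\cong\mathbb{Z}\quad\text{when } 1\le m_1<n-1.$$
   Context: A virtual knot diagram is the image of a generic immersion $S^1\to\mathbb{R}^2$ with finitely many transverse double points, each marked either as a classical crossing (with over/under information) or as a virtual (also called welded) crossing. A welded knot is an equivalence class of virtual knot diagrams under planar isotopy and finite sequences of: the classical Reidemeister moves; the virtual Reidemeister moves $vR_1,vR_2,vR_3$ (analogues of the Reidemeister moves with all crossings virtual); $vR_4$ (a strand having two consecutive virtual crossings is slid across a classical crossing); and the over-forbidden move $F_o$ (a strand that is the over-strand at two consecutive classical crossings is slid across a virtual crossing of the two other strands). Welding a classical crossing means replacing it by a virtual (welded) crossing. The fundamental group $G(K)$ of a welded knot $K$ is given by the Wirtinger presentation of any of its oriented diagrams: the generators are the arcs, an arc being the part of the diagram between two consecutive under-crossings (arcs continue through virtual crossings); each classical crossing with over-arc $y$ and under-arcs $x_r$ (on the right of the oriented over-arc) and $x_l$ (on its left) gives the relation $x_l=y\,x_r\,y^{-1}$; virtual crossings give no relation. (The opposite conjugation convention yields an isomorphic group.) The standard diagram of $K(2,2n+1)$ is the closure of the 2-braid $\sigma_1^{2n+1}$, whose $2n+1$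 crossings are cyclically ordered. Thus $K_{n,2,m_1}$ is the closure of the 2-strand virtual braid $\sigma_1^{m_1}\,v\,\sigma_1^{m_2}\,v$, where $v$ denotes a virtual crossing of the two strands. *)

theory Defs
  imports "HOL-Algebra.Elementary_Groups"
begin

section \<open>Groups given by generators and relations\<close>

text \<open>A letter \<open>(x, True)\<close> is the generator \<open>x\<close> and \<open>(x, False)\<close> is its formal inverse.\<close>

type_synonym 'g word = "('g \<times> bool) list"

definition words :: "'g set \<Rightarrow> 'g word set" where
  "words X = lists (X \<times> UNIV)"

inductive_set pres_cong :: "'g set \<Rightarrow> ('g word \<times> 'g word) set \<Rightarrow> ('g word \<times> 'g word) set"
  for X :: "'g set" and R :: "('g word \<times> 'g word) set" where
  refl: "w \<in> words X \<Longrightarrow> (w, w) \<in> pres_cong X R"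
| sym: "(v, w) \<in> pres_cong X R \<Longrightarrow> (w, v) \<in> pres_cong X R"
| trans: "(u, v) \<in> pres_cong X R \<Longrightarrow> (v, w) \<in> pres_cong X R \<Longrightarrow> (u, w) \<in> pres_cong X R"
| cancel: "u \<in> words X \<Longrightarrow> v \<in> words X \<Longrightarrow> x \<in> X
    \<Longrightarrow> (u @ [(x, b), (x, \<not> b)] @ v, u @ v) \<in> pres_cong X R"
| relator: "u \<in> words X \<Longrightarrow> v \<in> words X \<Longrightarrow> (r, s) \<in> R \<Longrightarrow> r \<in> words X \<Longrightarrow> s \<in> words X
    \<Longrightarrow> (u @ r @ v, u @ s @ v) \<in> pres_cong X R"

definition presented_group :: "'g set \<Rightarrow> ('g word \<times> 'g word) set \<Rightarrow> 'g word set monoid" where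
  "presented_group X R =
     \<lparr>carrier = words X // pres_cong X R,
      mult = (\<lambda>A B. \<Union>u\<in>A. \<Union>v\<in>B. pres_cong X R `` {u @ v}),
      one = pres_cong X R `` {[]}\<rparr>"

lemma words_append [simp]: "u @ v \<in> words X \<longleftrightarrow> u \<in> words X \<and> v \<in> words X"
  by (simp add: words_def)

lemma words_Nil [simp]: "[] \<in> words X"
  by (simp add: words_def)

lemma words_Cons [simp]: "(x, b) # w \<in> words X \<longleftrightarrow> x \<in> X \<and> w \<in> words X"
  by (auto simp: words_def)

lemma pres_cong_words: "(u, v) \<in> pres_cong X R \<Longrightarrow> u \<in> words X \<and> v \<in> words X"
  by (induction rule: pres_cong.induct) auto

lemma equiv_pres_cong: "equiv (words X) (pres_cong X R)"
proof (rule equivI)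
  show "pres_cong X R \<subseteq> words X \<times> words X"
    using pres_cong_words by fast
  show "refl_on (words X) (pres_cong X R)"
    by (simp add: refl_on_def pres_cong.refl)
  show "sym (pres_cong X R)"
    by (rule symI) (rule pres_cong.sym)
  show "trans (pres_cong X R)"
    by (rule transI) (rule pres_cong.trans)
qed

lemma pres_cong_context:
  "(u, v) \<in> pres_cong X R \<Longrightarrow> a \<in> words X \<Longrightarrow> b \<in> words X
    \<Longrightarrow> (a @ u @ b, a @ v @ b) \<in> pres_cong X R"
proof (induction rule: pres_cong.induct)
  case (refl w)
  then show ?case by (simp add: pres_cong.refl)
next
  case (sym v w)
  then show ?case by (simp add: pres_cong.sym)
next
  case (trans u v w)
  then show ?case by (metis pres_cong.trans)
next
  case (cancel u v x c)
  then show ?case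
    using pres_cong.cancel[of "a @ u" X "v @ b" x c R] by simp
next
  case (relator u v r s)
  then show ?case
    using pres_cong.relator[of "a @ u" X "v @ b" r s R] by simp
qed

lemma pres_cong_append:
  assumes "(u, u') \<in> pres_cong X R" "(v, v') \<in> pres_cong X R"
  shows "(u @ v, u' @ v') \<in> pres_cong X R"
proof (rule pres_cong.trans)
  show "(u @ v, u' @ v) \<in> pres_cong X R"
    using pres_cong_context[OF assms(1), of "[]" v] pres_cong_words[OF assms(2)] by simp
  show "(u' @ v, u' @ v') \<in> pres_cong X R"
    using pres_cong_context[OF assms(2), of u' "[]"] pres_cong_words[OF assms(1)] by simp
qed

lemma presented_group_mult:
  assumes "u \<in> words X" "v \<in> words X"
  shows "(pres_cong X R `` {u}) \<otimes>\<^bsub>presented_group X R\<^esub> (pres_cong X R `` {v})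
     = pres_cong X R `` {u @ v}"
proof -
  have "pres_cong X R `` {u' @ v'} = pres_cong X R `` {u @ v}"
    if "u' \<in> pres_cong X R `` {u}" "v' \<in> pres_cong X R `` {v}" for u' v'
  proof (rule equiv_class_eq[OF equiv_pres_cong])
    have "(u', u) \<in> pres_cong X R" "(v', v) \<in> pres_cong X R"
      using that by (simp_all add: pres_cong.sym)
    then show "(u' @ v', u @ v) \<in> pres_cong X R" by (rule pres_cong_append)
  qed
  moreover have "u \<in> pres_cong X R `` {u}" "v \<in> pres_cong X R `` {v}"
    using assms by (auto intro: pres_cong.refl)
  ultimately have "(\<Union>u'\<in>pres_cong X R `` {u}. \<Union>v'\<in>pres_cong X R `` {v}. pres_cong X R `` {u' @ v'})
      = pres_cong X R `` {u @ v}"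
    by blast
  then show ?thesis
    by (simp add: presented_group_def)
qed

definition word_inv :: "'g word \<Rightarrow> 'g word" where
  "word_inv w = rev (map (\<lambda>(x, b). (x, \<not> b)) w)"

lemma word_inv_words: "w \<in> words X \<Longrightarrow> word_inv w \<in> words X"
  by (auto simp: word_inv_def words_def)

lemma word_inv_cancel: "w \<in> words X \<Longrightarrow> (word_inv w @ w, []) \<in> pres_cong X R"
proof (induction w)
  case Nil
  then show ?case by (simp add: word_inv_def pres_cong.refl)
next
  case (Cons l w)
  obtain x b where l: "l = (x, b)" by fastforce
  have x: "x \<in> X" and w: "w \<in> words X" using Cons.prems l by auto
  have "word_inv (l # w) @ l # w = word_inv w @ [(x, \<not> b), (x, \<not> \<not> b)] @ w"
    by (simp add: l word_inv_def)
  moreover have "(word_inv w @ [(x, \<not> b), (x, \<not> \<not> b)] @ w, word_inv w @ w) \<in> pres_cong X R"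
    by (rule pres_cong.cancel[OF word_inv_words[OF w] w x])
  ultimately have "(word_inv (l # w) @ l # w, word_inv w @ w) \<in> pres_cong X R"
    by (simp only:)
  then show ?case by (rule pres_cong.trans) (rule Cons.IH[OF w])
qed

lemma group_presented_group: "group (presented_group X R)"
proof (rule groupI)
  have car: "\<exists>w\<in>words X. A = pres_cong X R `` {w}" if "A \<in> carrier (presented_group X R)" for A
    using that by (auto simp: presented_group_def quotient_def)
  have cls: "pres_cong X R `` {w} \<in> carrier (presented_group X R)" if "w \<in> words X" for w
    using that by (auto simp: presented_group_def intro: quotientI)
  have one: "\<one>\<^bsub>presented_group X R\<^esub> = pres_cong X R `` {[]}"
    by (simp add: presented_group_def)
  show "\<one>\<^bsub>presented_group X R\<^esub> \<in> carrier (presented_group X R)"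
    using cls one by simp
  fix A assume A: "A \<in> carrier (presented_group X R)"
  then obtain a where a: "a \<in> words X" "A = pres_cong X R `` {a}" using car by blast
  show "\<one>\<^bsub>presented_group X R\<^esub> \<otimes>\<^bsub>presented_group X R\<^esub> A = A"
    using a by (simp add: one presented_group_mult)
  show "\<exists>B\<in>carrier (presented_group X R). B \<otimes>\<^bsub>presented_group X R\<^esub> A = \<one>\<^bsub>presented_group X R\<^esub>"
  proof (rule bexI)
    have "pres_cong X R `` {word_inv a @ a} = pres_cong X R `` {[]}"
      using equiv_class_eq[OF equiv_pres_cong word_inv_cancel[OF a(1)]] .
    then show "(pres_cong X R `` {word_inv a}) \<otimes>\<^bsub>presented_group X R\<^esub> A = \<one>\<^bsub>presented_group X R\<^esub>"
      unfolding one a(2) presented_group_mult[OF word_inv_words[OF a(1)] a(1)] .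
    show "pres_cong X R `` {word_inv a} \<in> carrier (presented_group X R)"
      by (rule cls[OF word_inv_words[OF a(1)]])
  qed
  fix B assume B: "B \<in> carrier (presented_group X R)"
  then obtain b where b: "b \<in> words X" "B = pres_cong X R `` {b}" using car by blast
  show "A \<otimes>\<^bsub>presented_group X R\<^esub> B \<in> carrier (presented_group X R)"
    using a b by (simp add: presented_group_mult cls)
  fix C assume C: "C \<in> carrier (presented_group X R)"
  then obtain c where c: "c \<in> words X" "C = pres_cong X R `` {c}" using car by blast
  show "A \<otimes>\<^bsub>presented_group X R\<^esub> B \<otimes>\<^bsub>presented_group X R\<^esub> C
      = A \<otimes>\<^bsub>presented_group X R\<^esub> (B \<otimes>\<^bsub>presented_group X R\<^esub> C)"
    using a b c by (simp add: presented_group_mult)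
qed


section \<open>Oriented virtual knot diagrams and their groups\<close>

text \<open>
  Rotate the plane so that both strands run upwards through the crossing.  The strand coming
  from the edge \<open>sw\<close> (south-west) then leaves along \<open>ne\<close>, and the one coming from \<open>se\<close>
  leaves along \<open>nw\<close>.  In a \<open>Positive\<close> crossing the strand from \<open>sw\<close> to \<open>ne\<close> is the
  over-strand, in a \<open>Negative\<close> one it is the strand from \<open>se\<close> to \<open>nw\<close>; a \<open>Virtual\<close>
  (welded) crossing has neither.
\<close>

datatype crossing_kind = Positive | Negative | Virtual

datatype 'e crossing =
  Crossing (kind: crossing_kind) (sw: 'e) (se: 'e) (nw: 'e) (ne: 'e)

text \<open>
  A diagram is the list of its crossings, each recording the names of the four edges that
  meet there.  Edges are the pieces into which all crossings, virtual ones included, cut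
  the curve; each edge leaves one crossing and enters one crossing.  (Diagrams without any
  crossing are not represented.)
\<close>

type_synonym 'e diagram = "'e crossing list"

definition edges :: "'e diagram \<Rightarrow> 'e set" where
  "edges D = (\<Union>c\<in>set D. {sw c, se c, nw c, ne c})"

text \<open>The pairs of edges that follow each other along the knot without an under-crossing
  between them.\<close>

fun passes :: "'e crossing \<Rightarrow> ('e \<times> 'e) set" where
  "passes (Crossing Positive a b c d) = {(a, d)}"
| "passes (Crossing Negative a b c d) = {(b, c)}"
| "passes (Crossing Virtual a b c d) = {(a, d), (b, c)}"

definition same_arc :: "'e diagram \<Rightarrow> ('e \<times> 'e) set" where
  "same_arc D = (let P = (\<Union>c\<in>set D. passes c) in (P \<union> P\<inverse>)\<^sup>*)"

definition arc_of :: "'e diagram \<Rightarrow> 'e \<Rightarrow> 'e set" where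
  "arc_of D e = same_arc D `` {e}"

definition arcs :: "'e diagram \<Rightarrow> 'e set set" where
  "arcs D = arc_of D ` edges D"

text \<open>The relation \<open>x\<^sub>l = y x\<^sub>r y\<inverse>\<close>.  The over-strand from \<open>sw\<close> to \<open>ne\<close> has \<open>nw\<close> on its
  left and \<open>se\<close> on its right; the one from \<open>se\<close> to \<open>nw\<close> has \<open>sw\<close> on its left and \<open>ne\<close>
  on its right.\<close>

fun wirtinger :: "'e diagram \<Rightarrow> 'e crossing \<Rightarrow> ('e set word \<times> 'e set word) set" where
  "wirtinger D (Crossing Positive a b c d) =
     {([(arc_of D c, True)], [(arc_of D a, True), (arc_of D b, True), (arc_of D a, False)])}"
| "wirtinger D (Crossing Negative a b c d) =
     {([(arc_of D a, True)], [(arc_of D b, True), (arc_of D d, True), (arc_of D b, False)])}"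
| "wirtinger D (Crossing Virtual a b c d) = {}"

definition knot_group :: "'e diagram \<Rightarrow> 'e set word set monoid" where
  "knot_group D = presented_group (arcs D) (\<Union>c\<in>set D. wirtinger D c)"

definition weld :: "nat \<Rightarrow> 'e diagram \<Rightarrow> 'e diagram" where
  "weld i D = D[i := (case D ! i of Crossing k a b c d \<Rightarrow> Crossing Virtual a b c d)]"


section \<open>Closures of 2-strand virtual braids\<close>

text \<open>
  A word in \<open>\<sigma>\<^sub>1\<close> (\<open>Positive\<close>), \<open>\<sigma>\<^sub>1\<inverse>\<close> (\<open>Negative\<close>) and \<open>v\<close> (\<open>Virtual\<close>) is read from bottom to
  top.  The edges \<open>(i, False)\<close> and \<open>(i, True)\<close> are the left and the right strand just below
  letter number \<open>i\<close>; closing the braid identifies the level above the last letter with level \<open>0\<close>.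
\<close>

definition braid_closure :: "crossing_kind list \<Rightarrow> (nat \<times> bool) diagram" where
  "braid_closure w = map (\<lambda>i. let j = Suc i mod length w in
     Crossing (w ! i) (i, False) (i, True) (j, False) (j, True)) [0..<length w]"

definition torus_diagram :: "nat \<Rightarrow> (nat \<times> bool) diagram" where
  "torus_diagram n = braid_closure (replicate (2 * n + 1) Positive)"

lemma weld_braid_closure: "i < length w \<Longrightarrow> weld i (braid_closure w) = braid_closure (w[i := Virtual])"
  by (rule nth_equalityI) (auto simp: weld_def braid_closure_def Let_def nth_list_update)

text \<open>Welding the crossings \<open>m\<^sub>1\<close> and \<open>2n\<close> gives the closure of \<open>\<sigma>\<^sub>1\<^bsup>m\<^sub>1\<^esup> v \<sigma>\<^sub>1\<^bsup>m\<^sub>2\<^esup> v\<close>.\<close>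

lemma weld_torus_diagram:
  assumes "m1 < 2 * n"
  shows "weld m1 (weld (2 * n) (torus_diagram n)) =
    braid_closure (replicate m1 Positive @ [Virtual] @ replicate (2 * n - 1 - m1) Positive @ [Virtual])"
proof -
  have "(replicate N Positive)[2 * n := Virtual, m1 := Virtual] =
      replicate m1 Positive @ [Virtual] @ replicate (2 * n - 1 - m1) Positive @ [Virtual]"
    if "N = 2 * n + 1" for N
  proof (rule nth_equalityI)
    fix i assume "i < length ((replicate N Positive)[2 * n := Virtual, m1 := Virtual])"
    then have i: "i < N" by simp
    have N: "m1 < N" "2 * n < N" using assms that by simp_all
    from assms that i consider "i < m1" | "i = m1" | "m1 < i" "i < 2 * n" | "i = 2 * n" by linarith
    then show "(replicate N Positive)[2 * n := Virtual, m1 := Virtual] ! i =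
        (replicate m1 Positive @ [Virtual] @ replicate (2 * n - 1 - m1) Positive @ [Virtual]) ! i"
      using assms i N by cases (simp_all add: nth_append nth_list_update nth_Cons')
  next
    have "N = m1 + (1 + ((2 * n - 1 - m1) + 1))" using assms that by linarith
    then show "length ((replicate N Positive)[2 * n := Virtual, m1 := Virtual]) =
        length (replicate m1 Positive @ [Virtual] @ replicate (2 * n - 1 - m1) Positive @ [Virtual])"
      by (simp only: length_list_update length_replicate length_append list.size add_0 One_nat_def)
  qed
  then show ?thesis
    using assms by (simp add: torus_diagram_def weld_braid_closure del: replicate_Suc)
qed

text \<open>The crossings of \<open>torus_diagram n\<close> are numbered cyclically by \<open>0, \<dots>, 2n\<close>.  The first group
  below lies between crossings \<open>p\<close> and \<open>q\<close>, the second after \<open>q\<close> and before \<open>p\<close>.\<close>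

definition separates_into :: "nat \<Rightarrow> nat \<Rightarrow> nat \<Rightarrow> nat \<Rightarrow> nat \<Rightarrow> bool" where
  "separates_into n p q m m' \<longleftrightarrow> p < q \<and> q \<le> 2 * n \<and>
     (let A = {p<..<q}; B = {q<..2 * n} \<union> {..<p} in
       card A = m \<and> card B = m' \<or> card A = m' \<and> card B = m)"

end

theory Submission
  imports Defs
begin

text \<open>
  Let \<open>(a, b)\<close> be the meridians of the two strands at the start of the group of classical crossings
  of even size \<open>2k\<close>; the other group has size \<open>2l + 1\<close>.  Put \<open>x = a b\<close> and \<open>y = b a\<close>.
  A classical crossing preserves the product of the two strands, two of them conjugate both strands
  by it, and a welded crossing swaps the strands.  Going once around the closed braid therefore
  amounts to \<open>x\<^sup>k y = y x\<^sup>k\<close> and \<open>x\<^sup>l a x\<^sup>k = x\<^sup>k b x\<^sup>l\<close>.  If \<open>k = l\<close> or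
  \<open>k = l + 1\<close>, which is the case \<open>m\<^sub>1 = n - 1\<close>, this forces \<open>a = b\<close> and all meridians
  coincide.  Otherwise the diagram has a nontrivial Fox colouring modulo the odd number
  \<open>m\<^sub>2 - m\<^sub>1 \<ge> 3\<close>, which gives a non-abelian dihedral quotient.
\<close>

section \<open>Invariants of presented groups\<close>

lemma foldr_closed:
  assumes "w \<in> words X" "s \<in> S"
    and "\<And>x b s. x \<in> X \<Longrightarrow> s \<in> S \<Longrightarrow> act (x, b) s \<in> S"
  shows "foldr act w s \<in> S"
  using assms(1,2) by (induction w) (auto intro: assms(3))

text \<open>A letter action that respects inverses and relators factors through the presented group,
  so it can separate words. The set \<open>S\<close> is there because reflections reduced modulo
  \<open>Q\<close> undo each other only on reduced residues.\<close>

lemma pres_cong_foldr: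
  assumes "(u, v) \<in> pres_cong X R" "s \<in> S"
    and closed: "\<And>x b s. x \<in> X \<Longrightarrow> s \<in> S \<Longrightarrow> act (x, b) s \<in> S"
    and inverse: "\<And>x b s. x \<in> X \<Longrightarrow> s \<in> S \<Longrightarrow> act (x, b) (act (x, \<not> b) s) = s"
    and relator: "\<And>r r' s. (r, r') \<in> R \<Longrightarrow> s \<in> S \<Longrightarrow> foldr act r s = foldr act r' s"
  shows "foldr act u s = foldr act v s"
  using assms(1)
proof (induction rule: pres_cong.induct)
  case (cancel u v x b)
  have "foldr act v s \<in> S"
    by (rule foldr_closed[OF cancel(2) assms(2)]) (rule closed)
  then show ?case
    using inverse[OF cancel(3)] by simp
next
  case (relator u v r r')
  have "foldr act v s \<in> S"
    by (rule foldr_closed[OF relator(2) assms(2)]) (rule closed)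
  then show ?case
    using assms(5)[OF relator(3)] by simp
qed simp_all

lemma presented_group_class_closed:
  "w \<in> words X \<Longrightarrow> pres_cong X R `` {w} \<in> carrier (presented_group X R)"
  by (auto simp: presented_group_def intro: quotientI)

lemma presented_group_one: "\<one>\<^bsub>presented_group X R\<^esub> = pres_cong X R `` {[]}"
  by (simp add: presented_group_def)

lemma presented_group_class_eq_iff:
  assumes "u \<in> words X" "v \<in> words X"
  shows "pres_cong X R `` {u} = pres_cong X R `` {v} \<longleftrightarrow> (u, v) \<in> pres_cong X R"
  using eq_equiv_class_iff[OF equiv_pres_cong assms] .

lemma presented_group_class_Cons:
  assumes "x \<in> X" "w \<in> words X"
  shows "pres_cong X R `` {(x, b) # w} =
    pres_cong X R `` {[(x, b)]} \<otimes>\<^bsub>presented_group X R\<^esub> pres_cong X R `` {w}"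
  using assms presented_group_mult[of "[(x, b)]" X w R] by simp

lemma presented_group_letter_inv:
  assumes "x \<in> X"
  shows "pres_cong X R `` {[(x, False)]} = inv\<^bsub>presented_group X R\<^esub> (pres_cong X R `` {[(x, True)]})"
proof -
  interpret group "presented_group X R" by (rule group_presented_group)
  have "([(x, False), (x, True)], []) \<in> pres_cong X R"
    using pres_cong.cancel[of "[]" X "[]" x False R] assms by simp
  then have "pres_cong X R `` {[(x, False)]} \<otimes>\<^bsub>presented_group X R\<^esub> pres_cong X R `` {[(x, True)]} =
      \<one>\<^bsub>presented_group X R\<^esub>"
    using assms by (simp add: presented_group_mult presented_group_one presented_group_class_eq_iff)
  then show ?thesis
    using assms by (intro inv_equality[symmetric] presented_group_class_closed) auto
qed

text \<open>The exponent sum, written as a \<open>foldr\<close> so that its invariance becomes an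
  instance of \<open>pres_cong_foldr\<close>.\<close>

definition degree :: "'g word \<Rightarrow> int" where
  "degree w = foldr (\<lambda>(x, b) z. if b then z + 1 else z - 1) w 0"

lemma presented_group_class_degree:
  assumes "w \<in> words X" "t \<in> carrier (presented_group X R)"
    and gen: "\<And>x. x \<in> X \<Longrightarrow> pres_cong X R `` {[(x, True)]} = t"
  shows "pres_cong X R `` {w} = t [^]\<^bsub>presented_group X R\<^esub> degree w"
  using assms(1)
proof (induction w)
  case Nil
  then show ?case by (simp add: degree_def presented_group_one)
next
  case (Cons l w)
  interpret group "presented_group X R" by (rule group_presented_group)
  obtain x b where l: "l = (x, b)" by fastforce
  have x: "x \<in> X" and w: "w \<in> words X" using Cons.prems l by auto
  have "pres_cong X R `` {[(x, b)]} = t [^]\<^bsub>presented_group X R\<^esub> (if b then 1 else -1 :: int)"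
    using x gen[OF x] assms(2) by (simp add: presented_group_letter_inv int_pow_neg)
  moreover have "degree (l # w) = (if b then 1 else -1) + degree w"
    by (simp add: l degree_def)
  ultimately show ?case
    using Cons.IH[OF w] x w assms(2) by (simp only: l presented_group_class_Cons int_pow_mult)
qed

text \<open>As all generators coincide, every element is a power of a single \<open>t\<close>; the
  exponent sum is invariant under congruence and therefore recovers the exponent.\<close>

lemma presented_group_infinite_cyclic:
  assumes "X \<noteq> {}"
    and gen: "\<And>x y. x \<in> X \<Longrightarrow> y \<in> X \<Longrightarrow>
      pres_cong X R `` {[(x, True)]} = pres_cong X R `` {[(y, True)]}"
    and rel: "\<And>u v. (u, v) \<in> pres_cong X R \<Longrightarrow> degree u = degree v"
  shows "presented_group X R \<cong> integer_group"
proof -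
  interpret group "presented_group X R" by (rule group_presented_group)
  obtain x where x: "x \<in> X" using assms(1) by blast
  define t where "t = pres_cong X R `` {[(x, True)]}"
  have t: "t \<in> carrier (presented_group X R)"
    using x by (auto simp: t_def intro: presented_group_class_closed)
  have cls: "pres_cong X R `` {w} = t [^]\<^bsub>presented_group X R\<^esub> degree w" if "w \<in> words X" for w
    using presented_group_class_degree[OF that t gen[OF _ x, folded t_def]] by simp
  \<comment> \<open>A word of exponent sum \<open>i\<close> representing the \<open>i\<close>-th
    power of \<open>t\<close>.\<close>
  define pw where "pw i = replicate (nat \<bar>i\<bar>) (x, i \<ge> 0)" for i :: int
  have pw: "pw i \<in> words X" for i
    using x by (auto simp: pw_def words_def)
  have "degree (replicate k (x, b)) = (if b then int k else - int k)" for k b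
    by (induction k) (auto simp: degree_def)
  then have deg: "degree (pw i) = i" for i
    by (simp add: pw_def)
  have "(\<lambda>i. t [^]\<^bsub>presented_group X R\<^esub> (i::int)) \<in> iso integer_group (presented_group X R)"
    unfolding iso_iff
  proof (intro conjI)
    show "(\<lambda>i. t [^]\<^bsub>presented_group X R\<^esub> (i::int)) \<in> hom integer_group (presented_group X R)"
      by (rule hom_integer_group_pow[OF t])
    show "(\<lambda>i. t [^]\<^bsub>presented_group X R\<^esub> (i::int)) ` carrier integer_group =
        carrier (presented_group X R)"
    proof
      show "carrier (presented_group X R) \<subseteq>
          (\<lambda>i. t [^]\<^bsub>presented_group X R\<^esub> (i::int)) ` carrier integer_group"
      proof
        fix A assume "A \<in> carrier (presented_group X R)"
        then obtain w where "w \<in> words X" "A = pres_cong X R `` {w}"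
          by (auto simp: presented_group_def quotient_def)
        then show "A \<in> (\<lambda>i. t [^]\<^bsub>presented_group X R\<^esub> (i::int)) ` carrier integer_group"
          by (simp add: cls)
      qed
    qed (use t in auto)
    show "inj_on (\<lambda>i. t [^]\<^bsub>presented_group X R\<^esub> (i::int)) (carrier integer_group)"
    proof (rule inj_onI)
      fix i j :: int
      assume "t [^]\<^bsub>presented_group X R\<^esub> i = t [^]\<^bsub>presented_group X R\<^esub> j"
      then have "(pw i, pw j) \<in> pres_cong X R"
        by (simp add: presented_group_class_eq_iff[OF pw pw, symmetric] cls[OF pw] deg)
      then show "i = j" using rel[of "pw i" "pw j"] by (simp add: deg)
    qed
  qed
  then show ?thesis
    using group.iso_sym[OF group_integer_group] is_isoI by blast
qed

section \<open>Wirtinger groups\<close>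

lemma equiv_same_arc: "equiv UNIV (same_arc D)"
  unfolding same_arc_def Let_def
  by (rule equivI) (simp_all add: refl_rtrancl sym_rtrancl trans_rtrancl sym_Un_converse)

lemma arc_of_eq_iff: "arc_of D e = arc_of D e' \<longleftrightarrow> (e, e') \<in> same_arc D"
  unfolding arc_of_def by (rule eq_equiv_class_iff[OF equiv_same_arc UNIV_I UNIV_I])

lemma arc_of_passes: "c \<in> set D \<Longrightarrow> (e, e') \<in> passes c \<Longrightarrow> arc_of D e = arc_of D e'"
  unfolding arc_of_eq_iff same_arc_def Let_def by (rule r_into_rtrancl) (rule UnI1, rule UN_I)

lemma arc_of_in_arcs:
  assumes "Crossing k a b c d \<in> set D"
  shows "arc_of D a \<in> arcs D" "arc_of D b \<in> arcs D" "arc_of D c \<in> arcs D" "arc_of D d \<in> arcs D"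
  unfolding arcs_def edges_def by (rule imageI, rule UN_I[OF assms], simp)+

text \<open>Indexed by edges rather than arcs, so that each crossing yields its relation directly in
  terms of its four edges.\<close>

definition meridian :: "'e diagram \<Rightarrow> 'e \<Rightarrow> 'e set word set" where
  "meridian D e = pres_cong (arcs D) (\<Union>c\<in>set D. wirtinger D c) `` {[(arc_of D e, True)]}"

lemma meridian_closed: "e \<in> edges D \<Longrightarrow> meridian D e \<in> carrier (knot_group D)"
  unfolding meridian_def knot_group_def
  by (rule presented_group_class_closed) (simp add: arcs_def)

lemma meridian_Virtual:
  assumes "Crossing Virtual a b c d \<in> set D"
  shows "meridian D d = meridian D a" "meridian D c = meridian D b"
  using arc_of_passes[OF assms, of a d] arc_of_passes[OF assms, of b c]
  by (simp_all add: meridian_def)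

text \<open>The Wirtinger relation is multiplied on the right by the over-meridian. In this
  inverse-free form it says that the product of left and right strand is preserved.\<close>

lemma meridian_Positive:
  assumes "Crossing Positive a b c d \<in> set D"
  shows "meridian D d = meridian D a"
    and "meridian D c \<otimes>\<^bsub>knot_group D\<^esub> meridian D a = meridian D a \<otimes>\<^bsub>knot_group D\<^esub> meridian D b"
proof -
  show "meridian D d = meridian D a"
    using arc_of_passes[OF assms, of a d] by (simp add: meridian_def)
  let ?R = "\<Union>c\<in>set D. wirtinger D c" and ?X = "arcs D"
  let ?a = "arc_of D a" and ?b = "arc_of D b" and ?c = "arc_of D c"
  note X = arc_of_in_arcs[OF assms]
  have rel: "([(?c, True)], [(?a, True), (?b, True), (?a, False)]) \<in> ?R"
    by (rule UN_I[OF assms]) simp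
  have "([(?c, True), (?a, True)], [(?a, True), (?b, True), (?a, False), (?a, True)]) \<in> pres_cong ?X ?R"
    using pres_cong.relator[OF _ _ rel, of "[]" ?X "[(?a, True)]"] X
    by (simp del: UN_iff)
  moreover have "([(?a, True), (?b, True), (?a, False), (?a, True)], [(?a, True), (?b, True)]) \<in> pres_cong ?X ?R"
    using pres_cong.cancel[of "[(?a, True), (?b, True)]" ?X "[]" ?a False ?R] X
    by (simp del: UN_iff)
  ultimately have "([(?c, True), (?a, True)], [(?a, True), (?b, True)]) \<in> pres_cong ?X ?R"
    by (rule pres_cong.trans)
  then show "meridian D c \<otimes>\<^bsub>knot_group D\<^esub> meridian D a = meridian D a \<otimes>\<^bsub>knot_group D\<^esub> meridian D b"
    using X by (simp add: meridian_def knot_group_def presented_group_mult presented_group_class_eq_iff)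
qed

text \<open>Each side of a Wirtinger relation is a generator or a conjugate of one, hence has
  exponent sum 1.\<close>

lemma wirtinger_degree:
  assumes "(u, v) \<in> pres_cong (arcs D) (\<Union>c\<in>set D. wirtinger D c)"
  shows "degree u = degree v"
  unfolding degree_def
proof (rule pres_cong_foldr[OF assms, where S = UNIV])
  fix r r' and s :: int
  assume "(r, r') \<in> (\<Union>c\<in>set D. wirtinger D c)"
  then obtain c where "c \<in> set D" "(r, r') \<in> wirtinger D c" by blast
  then show "foldr (\<lambda>(x, b) z. if b then z + 1 else z - 1) r s =
      foldr (\<lambda>(x, b) z. if b then z + 1 else z - 1) r' s"
    by (cases "(D, c)" rule: wirtinger.cases) auto
qed auto

lemma knot_group_infinite_cyclic:
  assumes "D \<noteq> []" and "\<And>e. e \<in> edges D \<Longrightarrow> meridian D e = t"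
  shows "knot_group D \<cong> integer_group"
  unfolding knot_group_def
proof (rule presented_group_infinite_cyclic)
  show "arcs D \<noteq> {}"
    using assms(1) by (cases D) (auto simp: arcs_def edges_def)
next
  fix x y assume "x \<in> arcs D" "y \<in> arcs D"
  then show "pres_cong (arcs D) (\<Union> (wirtinger D ` set D)) `` {[(x, True)]} =
      pres_cong (arcs D) (\<Union> (wirtinger D ` set D)) `` {[(y, True)]}"
    using assms(2) by (auto simp: arcs_def meridian_def)
qed (rule wirtinger_degree)

section \<open>Fox colourings\<close>

text \<open>The dihedral colouring condition modulo \<open>Q\<close>: the over-colour is the
  midpoint of the two under-colours. Colours are integers, so that a colouring can be given by an
  explicit integer formula.\<close>

fun fox_rule :: "int \<Rightarrow> ('e \<Rightarrow> int) \<Rightarrow> 'e crossing \<Rightarrow> bool" where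
  "fox_rule Q f (Crossing Positive a b c d) \<longleftrightarrow> Q dvd f d - f a \<and> Q dvd f b + f c - 2 * f a"
| "fox_rule Q f (Crossing Negative a b c d) \<longleftrightarrow> Q dvd f c - f b \<and> Q dvd f a + f d - 2 * f b"
| "fox_rule Q f (Crossing Virtual a b c d) \<longleftrightarrow> Q dvd f d - f a \<and> Q dvd f c - f b"

lemma fox_rule_passes:
  "fox_rule Q f c \<Longrightarrow> (e, e') \<in> passes c \<Longrightarrow> f e mod Q = f e' mod Q"
  by (cases "(Q, f, c)" rule: fox_rule.cases) (auto simp: mod_eq_dvd_iff dvd_diff_commute)

text \<open>Makes the colour modulo \<open>Q\<close> a function of the arc, hence of the
  generator.\<close>

lemma fox_rule_same_arc:
  assumes "\<And>c. c \<in> set D \<Longrightarrow> fox_rule Q f c" and "(e, e') \<in> same_arc D"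
  shows "f e mod Q = f e' mod Q"
  using assms(2) unfolding same_arc_def Let_def
proof (induction rule: rtrancl_induct)
  case (step e' e'')
  then show ?case using fox_rule_passes[OF assms(1)] by (metis (no_types, lifting) UN_E Un_iff converse_iff)
qed simp

text \<open>The generator of an arc of colour \<open>k\<close> acts on the integers modulo \<open>Q\<close> as the reflection
  \<open>z \<mapsto> 2k - z\<close>; two reflections commute only if their colours agree, as \<open>Q\<close> is odd.\<close>

lemma fox_colouring_not_infinite_cyclic:
  assumes "odd Q" "Q > 0"
    and fox: "\<And>c. c \<in> set D \<Longrightarrow> fox_rule Q f c"
    and e: "e \<in> edges D" "e' \<in> edges D" "\<not> Q dvd f e - f e'"
  shows "\<not> knot_group D \<cong> integer_group"
proof
  assume iso: "knot_group D \<cong> integer_group"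
  let ?R = "\<Union>c\<in>set D. wirtinger D c" and ?X = "arcs D"
  have grp: "group (knot_group D)"
    by (simp add: knot_group_def group_presented_group)
  have "comm_group (knot_group D)"
    using comm_group.iso_imp_comm_group[OF abelian_integer_group group.iso_sym[OF grp iso]]
      group.is_monoid[OF grp] by blast
  moreover have X: "arc_of D e \<in> ?X" "arc_of D e' \<in> ?X" using e by (auto simp: arcs_def)
  ultimately have "meridian D e \<otimes>\<^bsub>knot_group D\<^esub> meridian D e' =
      meridian D e' \<otimes>\<^bsub>knot_group D\<^esub> meridian D e"
    using e by (intro comm_monoid.m_comm comm_group.axioms meridian_closed)
  then have comm: "([(arc_of D e, True), (arc_of D e', True)], [(arc_of D e', True), (arc_of D e, True)])
      \<in> pres_cong ?X ?R"
    using X by (simp add: meridian_def knot_group_def presented_group_mult presented_group_class_eq_iff)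
  \<comment> \<open>The boolean is ignored because a reflection is its own inverse.
    \<open>SOME\<close> picks an edge of the arc; the next fact shows that modulo \<open>Q\<close>
    the choice does not matter.\<close>
  define act where "act = (\<lambda>(A, b::bool) z. (2 * f (SOME e. arc_of D e = A) - z) mod Q)"
  have act: "act (arc_of D e, b) z = (2 * f e - z) mod Q" for e b z
  proof -
    have "(SOME e'. arc_of D e' = arc_of D e, e) \<in> same_arc D"
      unfolding arc_of_eq_iff[symmetric] by (rule someI[of _ e]) simp
    then have "f (SOME e'. arc_of D e' = arc_of D e) mod Q = f e mod Q"
      using fox_rule_same_arc[OF fox] by blast
    then show ?thesis
      unfolding act_def prod.case by (intro mod_diff_cong mod_mult_cong) auto
  qed
  \<comment> \<open>At 0 the two products of reflections give \<open>2 * f e - 2 * f e'\<close> and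
    its negative modulo \<open>Q\<close>. Equality makes \<open>Q\<close> divide four times the
    colour difference, and oddness removes the 4.\<close>
  have "foldr act [(arc_of D e, True), (arc_of D e', True)] 0 =
      foldr act [(arc_of D e', True), (arc_of D e, True)] 0"
  proof (rule pres_cong_foldr[OF comm, where S = "{0..<Q}"])
    fix r r' s
    assume "(r, r') \<in> ?R" "s \<in> {0..<Q}"
    then obtain c where c: "c \<in> set D" "(r, r') \<in> wirtinger D c" by blast
    obtain k x y z w where k: "c = Crossing k x y z w" by (cases c)
    show "foldr act r s = foldr act r' s"
    proof (cases k)
      case Positive
      then have "Q dvd 2 * (f y + f z - 2 * f x)"
        using fox[OF c(1)] k by (intro dvd_mult) simp
      then show ?thesis
        using Positive k c(2) by (auto simp: act mod_simps mod_eq_dvd_iff algebra_simps)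
    next
      case Negative
      then have "Q dvd 2 * (f x + f w - 2 * f y)"
        using fox[OF c(1)] k by (intro dvd_mult) simp
      then show ?thesis
        using Negative k c(2) by (auto simp: act mod_simps mod_eq_dvd_iff algebra_simps)
    qed (use c k in auto)
  next
    fix A b s assume "A \<in> ?X" "s \<in> {0..<Q}"
    then show "act (A, b) (act (A, \<not> b) s) = s"
      by (auto simp: act_def mod_simps)
  qed (use \<open>Q > 0\<close> in \<open>auto simp: act_def\<close>)
  then have "Q dvd 4 * (f e - f e')"
    by (simp add: act mod_simps mod_eq_dvd_iff algebra_simps)
  moreover have "coprime Q 4"
    using \<open>odd Q\<close> coprime_power_right_iff[of Q 2 2] by simp
  ultimately show False
    using e(3) coprime_dvd_mult_right_iff by blast
qed


section \<open>Cyclic sequences of conjugations\<close>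

context group
begin

text \<open>The product of the two strands is constant along a run of classical crossings, and two
  crossings conjugate both strands by it.\<close>

lemma run_product:
  assumes "\<And>i. i < m \<Longrightarrow> l (Suc i) \<otimes> l i = l i \<otimes> r i" "\<And>i. i < m \<Longrightarrow> r (Suc i) = l i"
    and "i \<le> m"
  shows "l i \<otimes> r i = l 0 \<otimes> r 0"
  using assms(3) by (induction i) (simp_all add: assms(1,2))

lemma run_conj:
  assumes car: "\<And>i. l i \<in> carrier G" "\<And>i. r i \<in> carrier G"
    and step: "\<And>i. i < m \<Longrightarrow> l (Suc i) \<otimes> l i = l i \<otimes> r i" "\<And>i. i < m \<Longrightarrow> r (Suc i) = l i"
    and "2 * k \<le> m"
  shows "l (2 * k) \<otimes> (l 0 \<otimes> r 0) [^] k = (l 0 \<otimes> r 0) [^] k \<otimes> l 0 \<and>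
    r (2 * k) \<otimes> (l 0 \<otimes> r 0) [^] k = (l 0 \<otimes> r 0) [^] k \<otimes> r 0"
  using assms(5)
proof (induction k)
  case 0
  then show ?case using car by simp
next
  case (Suc k)
  define x where "x = l 0 \<otimes> r 0"
  have x: "x \<in> carrier G" using car by (simp add: x_def)
  have prod: "l i \<otimes> r i = x" if "i \<le> m" for i
    unfolding x_def using run_product[of m l r i] step that by simp
  let ?i = "2 * k"
  have le: "?i < m" "Suc ?i < m" using Suc.prems by simp_all
  have l1: "l (Suc ?i) \<otimes> l ?i = x" using step(1)[OF le(1)] prod[of ?i] le by simp
  have l2: "l (Suc (Suc ?i)) \<otimes> l (Suc ?i) = x"
    using prod[of "Suc (Suc ?i)"] step(2)[OF le(2)] le by simp
  have r2: "r (Suc (Suc ?i)) = l (Suc ?i)" by (rule step(2)[OF le(2)])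
  \<comment> \<open>Regrouping: \<open>x\<close> is the product of any two consecutive left strands
    here, so a third one multiplied onto it from the left splits off another
    \<open>x\<close>.\<close>
  have "l (Suc (Suc ?i)) \<otimes> x = x \<otimes> l ?i"
    using l1 l2 car by (metis m_assoc)
  moreover have "r (Suc (Suc ?i)) \<otimes> x = x \<otimes> r ?i"
    unfolding r2 using l1 prod[of ?i] le car by (metis m_assoc less_imp_le)
  moreover have "l ?i \<otimes> x [^] k = x [^] k \<otimes> l 0" "r ?i \<otimes> x [^] k = x [^] k \<otimes> r 0"
    using Suc by (simp_all add: x_def)
  moreover have "x [^] Suc k = x \<otimes> x [^] k"
    using x nat_pow_Suc2 by blast
  ultimately have "l (Suc (Suc ?i)) \<otimes> x [^] Suc k = x [^] Suc k \<otimes> l 0"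
      "r (Suc (Suc ?i)) \<otimes> x [^] Suc k = x [^] Suc k \<otimes> r 0"
    using x car by (simp_all only: m_assoc[symmetric] nat_pow_closed m_closed)
      (simp_all only: m_assoc nat_pow_closed m_closed)
  then show ?case by (simp add: x_def)
qed

lemma pow_intertwine:
  assumes "u \<in> carrier G" "x \<in> carrier G" "y \<in> carrier G" "u \<otimes> x = y \<otimes> u"
  shows "u \<otimes> x [^] (k::nat) = y [^] k \<otimes> u"
proof (induction k)
  case (Suc k)
  have "u \<otimes> x [^] Suc k = (u \<otimes> x [^] k) \<otimes> x" using assms by (simp add: m_assoc)
  also have "\<dots> = y [^] k \<otimes> (u \<otimes> x)" using assms Suc by (simp add: m_assoc)
  also have "\<dots> = y [^] Suc k \<otimes> u" using assms by (simp add: m_assoc[symmetric])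
  finally show ?case .
qed (use assms in simp)

text \<open>\<open>(a, b)\<close> and \<open>(c, d)\<close> are the strands before and after the even run, and \<open>(d, c)\<close> and
  \<open>(b, a)\<close> those before and after the odd one.\<close>

lemma balanced_runs_eq:
  assumes car: "a \<in> carrier G" "b \<in> carrier G" "c \<in> carrier G" "d \<in> carrier G"
    and c: "c \<otimes> (a \<otimes> b) [^] k = (a \<otimes> b) [^] k \<otimes> a"
    and d: "d \<otimes> (a \<otimes> b) [^] k = (a \<otimes> b) [^] k \<otimes> b"
    and dc: "d \<otimes> c = b \<otimes> a"
    and a: "a \<otimes> (b \<otimes> a) [^] l = (b \<otimes> a) [^] l \<otimes> d"
    and kl: "k = l \<or> k = Suc l"
  shows "a = b"
proof -
  define x y where "x = a \<otimes> b" and "y = b \<otimes> a"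
  have x: "x \<in> carrier G" and y: "y \<in> carrier G" using car by (simp_all add: x_def y_def)
  have c': "c \<otimes> x [^] k = x [^] k \<otimes> a" and d': "d \<otimes> x [^] k = x [^] k \<otimes> b"
    and a': "a \<otimes> y [^] l = y [^] l \<otimes> d" and dc': "d \<otimes> c = y"
    using c d a dc by (simp_all add: x_def y_def)
  \<comment> \<open>Writing \<open>y\<close> as \<open>d \<otimes> c\<close> and moving both factors
    past \<open>x [^] k\<close> turns them into \<open>b\<close> and \<open>a\<close>, so
    \<open>y\<close> commutes with \<open>x [^] k\<close>.\<close>
  have "y \<otimes> x [^] k = d \<otimes> (x [^] k \<otimes> a)"
    using car x by (simp add: dc'[symmetric] c'[symmetric] m_assoc)
  also have "\<dots> = x [^] k \<otimes> y"
    using car x by (simp add: m_assoc[symmetric] d') (simp add: m_assoc y_def)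
  finally have comm: "y [^] l \<otimes> x [^] k = x [^] k \<otimes> y [^] l"
    using pow_intertwine[of "x [^] k" y y l] x y by simp
  have ay: "a \<otimes> y [^] l = x [^] l \<otimes> a"
    using pow_intertwine[of a y x l] car by (simp add: x_def y_def m_assoc)
  have bx: "b \<otimes> x [^] l = y [^] l \<otimes> b"
    using pow_intertwine[of b x y l] car by (simp add: x_def y_def m_assoc)
  \<comment> \<open>Chain: \<open>x\<^sup>l a x\<^sup>k = a y\<^sup>l x\<^sup>k = y\<^sup>l d
    x\<^sup>k = y\<^sup>l x\<^sup>k b = x\<^sup>k y\<^sup>l b = x\<^sup>k b
    x\<^sup>l\<close>.\<close>
  have "x [^] l \<otimes> (a \<otimes> x [^] k) = y [^] l \<otimes> (d \<otimes> x [^] k)"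
    using car x y a' ay by (simp add: m_assoc[symmetric])
  also have "\<dots> = x [^] k \<otimes> (b \<otimes> x [^] l)"
    using car x y unfolding d' bx by (simp add: m_assoc[symmetric] comm)
  finally have main: "x [^] l \<otimes> (a \<otimes> x [^] k) = x [^] k \<otimes> (b \<otimes> x [^] l)" .
  from kl show ?thesis
  proof
    assume "k = l"
    then show ?thesis using main car x by simp
  next
    assume k: "k = Suc l"
    have "x [^] l \<otimes> (a \<otimes> (x \<otimes> x [^] l)) = x [^] l \<otimes> (x \<otimes> (b \<otimes> x [^] l))"
      using main car x nat_pow_Suc2[OF x, of l] k by (simp add: m_assoc)
    then have "(a \<otimes> x) \<otimes> x [^] l = (x \<otimes> b) \<otimes> x [^] l"
      using car x by (simp add: m_assoc)
    \<comment> \<open>With \<open>x = a \<otimes> b\<close> this reads \<open>a a b = a b b\<close>,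
      and cancelling leaves \<open>a = b\<close>.\<close>
    then have "a \<otimes> x = x \<otimes> b" using car x by simp
    then show ?thesis using car by (simp add: x_def m_assoc)
  qed
qed

text \<open>The cycle is read from just after a welded crossing, even run first; position
  \<open>m\<close> is the other weld, and the weld at \<open>N - 1\<close> closes the cycle. This
  supplies the relations of \<open>balanced_runs_eq\<close>.\<close>

lemma welded_cycle_start:
  assumes car: "\<And>i. l i \<in> carrier G" "\<And>i. r i \<in> carrier G"
    and run: "\<And>i. i < N \<Longrightarrow> i \<noteq> m \<Longrightarrow> i \<noteq> N - 1 \<Longrightarrow> l (Suc i) \<otimes> l i = l i \<otimes> r i \<and> r (Suc i) = l i"
    and weld: "\<And>i. i = m \<or> i = N - 1 \<Longrightarrow> l (Suc i) = r i \<and> r (Suc i) = l i"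
    and cyc: "l N = l 0" "r N = r 0"
    and N: "N = m + m' + 2"
    and m: "m = 2 * k" "m' = 2 * j + 1" "k = j \<or> k = Suc j"
  shows "l 0 = r 0"
proof -
  define l' r' where "l' i = l (Suc m + i)" and "r' i = r (Suc m + i)" for i
  have car': "l' i \<in> carrier G" "r' i \<in> carrier G" for i using car by (simp_all add: l'_def r'_def)
  have run1: "l (Suc i) \<otimes> l i = l i \<otimes> r i" "r (Suc i) = l i" if "i < m" for i
    using run[of i] that N by auto
  have run2: "l' (Suc i) \<otimes> l' i = l' i \<otimes> r' i" "r' (Suc i) = l' i" if "i < m'" for i
    using run[of "Suc m + i"] that N by (auto simp: l'_def r'_def)
  have s1: "l' 0 = r m" "r' 0 = l m" using weld[of m] by (auto simp: l'_def r'_def)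
  have s2: "l' m' = r 0" "r' m' = l 0" using weld[of "N - 1"] cyc N by (auto simp: l'_def r'_def)
  have "l' 0 \<otimes> r' 0 = r 0 \<otimes> l 0"
    using run_product[of m' l' r' m'] run2 s2 by simp
  then have dc: "r m \<otimes> l m = r 0 \<otimes> l 0" using s1 by simp
  have "l m \<otimes> (l 0 \<otimes> r 0) [^] k = (l 0 \<otimes> r 0) [^] k \<otimes> l 0 \<and>
      r m \<otimes> (l 0 \<otimes> r 0) [^] k = (l 0 \<otimes> r 0) [^] k \<otimes> r 0"
    unfolding m(1) by (intro run_conj[of l r m k, unfolded m(1)] car run1[unfolded m(1)]) simp_all
  moreover have "l' (2 * j) \<otimes> (l' 0 \<otimes> r' 0) [^] j = (l' 0 \<otimes> r' 0) [^] j \<otimes> l' 0"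
    using m by (intro conjunct1[OF run_conj[of l' r' m' j]] car' run2) simp_all
  \<comment> \<open>The unpaired last crossing of the odd run hands its left strand over to the
    right, where the closing weld identifies it with \<open>l 0\<close>.\<close>
  moreover have "l' (2 * j) = l 0" using run2(2)[of "2 * j"] s2 m by simp
  ultimately show ?thesis
    using balanced_runs_eq[of "l 0" "r 0" "l m" "r m" k j] car dc s1 m(3) by simp
qed

end

section \<open>The diagrams\<close>

definition welded_word :: "nat \<Rightarrow> nat \<Rightarrow> nat \<Rightarrow> crossing_kind list" where
  "welded_word n p q = (replicate (2 * n + 1) Positive)[q := Virtual, p := Virtual]"

lemma length_welded_word [simp]: "length (welded_word n p q) = 2 * n + 1"
  by (simp add: welded_word_def del: replicate_Suc)

lemma nth_welded_word:
  assumes "p < q" "q \<le> 2 * n" "i < 2 * n + 1"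
  shows "welded_word n p q ! i = (if i = p \<or> i = q then Virtual else Positive)"
  using assms by (simp add: welded_word_def nth_list_update del: replicate_Suc)

lemma weld_torus_diagram_eq:
  "p < q \<Longrightarrow> q \<le> 2 * n \<Longrightarrow> weld p (weld q (torus_diagram n)) = braid_closure (welded_word n p q)"
  by (simp add: torus_diagram_def weld_braid_closure welded_word_def del: replicate_Suc)

lemma set_braid_closure:
  "set (braid_closure w) = (\<lambda>i. let j = Suc i mod length w in
     Crossing (w ! i) (i, False) (i, True) (j, False) (j, True)) ` {..<length w}"
  by (simp add: braid_closure_def atLeast0LessThan)

lemma edges_braid_closure: "edges (braid_closure w) = {..<length w} \<times> UNIV"
proof (cases "w = []")
  case False
  then have "Suc i mod length w < length w" for i by simp
  moreover have "(i, b) \<in> edges (braid_closure w)" if "i < length w" for i b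
    unfolding edges_def
    by (rule UN_I[of "braid_closure w ! i"]) (use that in \<open>cases b; simp add: braid_closure_def Let_def\<close>)+
  ultimately show ?thesis
    by (auto simp: edges_def set_braid_closure Let_def)
qed (simp add: edges_def braid_closure_def)

lemma separates_into_lengths:
  assumes "separates_into n p q m m'"
  shows "p < q" "q \<le> 2 * n"
    and "q - p - 1 = m \<and> 2 * n - q + p = m' \<or> q - p - 1 = m' \<and> 2 * n - q + p = m"
proof -
  show pq: "p < q" "q \<le> 2 * n" using assms by (simp_all add: separates_into_def)
  have "card ({q<..2 * n} \<union> {..<p}) = 2 * n - q + p"
    using pq by (subst card_Un_disjoint) auto
  then show "q - p - 1 = m \<and> 2 * n - q + p = m' \<or> q - p - 1 = m' \<and> 2 * n - q + p = m"
    using assms pq by (auto simp: separates_into_def Let_def)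
qed

text \<open>Once the two strands agree at one level, the common meridian propagates through every
  crossing and around the whole closure.\<close>

lemma welded_torus_cyclic:
  assumes pq: "p < q" "q \<le> 2 * n"
    and bal: "q - p - 1 = Suc (2 * n - q + p) \<or> 2 * n - q + p = Suc (q - p - 1)"
  shows "knot_group (braid_closure (welded_word n p q)) \<cong> integer_group"
proof -
  define N where "N = 2 * n + 1"
  let ?D = "braid_closure (welded_word n p q)"
  interpret group "knot_group ?D" by (simp add: knot_group_def group_presented_group)
  \<comment> \<open>Extended periodically to all naturals, so that reading can start after either
    weld without case splits at the closing level.\<close>
  define l r where "l i = meridian ?D (i mod N, False)" and "r i = meridian ?D (i mod N, True)" for i
  have len: "length (welded_word n p q) = N" and N0: "0 < N" and qN: "q < N"
    using pq by (simp_all add: N_def)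
  have edges: "edges ?D = {..<N} \<times> UNIV" by (simp only: edges_braid_closure len)
  have car: "l i \<in> carrier (knot_group ?D)" "r i \<in> carrier (knot_group ?D)" for i
    using N0 by (simp_all add: l_def r_def edges meridian_closed)
  have cross: "Crossing (if i mod N = p \<or> i mod N = q then Virtual else Positive)
      (i mod N, False) (i mod N, True) (Suc i mod N, False) (Suc i mod N, True) \<in> set ?D" for i
  proof -
    have i: "i mod N < N" using N0 by simp
    then have "welded_word n p q ! (i mod N) = (if i mod N = p \<or> i mod N = q then Virtual else Positive)"
      using nth_welded_word[OF pq] by (simp only: N_def)
    then show ?thesis
      unfolding set_braid_closure len
      by (intro image_eqI[of _ _ "i mod N"]) (simp_all only: Let_def mod_Suc_eq lessThan_iff i)
  qed
  have run: "l (Suc i) \<otimes>\<^bsub>knot_group ?D\<^esub> l i = l i \<otimes>\<^bsub>knot_group ?D\<^esub> r i \<and> r (Suc i) = l i"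
    if "i mod N \<noteq> p" "i mod N \<noteq> q" for i
    using meridian_Positive[of "(i mod N, False)" "(i mod N, True)" "(Suc i mod N, False)" "(Suc i mod N, True)" ?D]
      cross[of i] that by (simp add: l_def r_def)
  have weld: "l (Suc i) = r i \<and> r (Suc i) = l i" if "i mod N = p \<or> i mod N = q" for i
  proof -
    have "Crossing Virtual (i mod N, False) (i mod N, True) (Suc i mod N, False) (Suc i mod N, True) \<in> set ?D"
      using cross[of i] that by (simp only: if_True)
    from meridian_Virtual[OF this] show ?thesis unfolding l_def r_def by blast
  qed
  \<comment> \<open>\<open>s\<close> is the weld preceding the even run, of length \<open>m\<close>;
    the second alternative for \<open>s\<close> wraps around the closure.\<close>
  have start: "l (Suc s) = r (Suc s)"
    if m: "m = 2 * k" "m' = 2 * j + 1" "k = j \<or> k = Suc j" and N: "N = m + m' + 2"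
      and s: "s = p \<and> Suc s + m = q \<or> s = q \<and> Suc s + m = N + p" for s m m' k j
  proof -
    have mod: "(Suc s + i) mod N = p \<or> (Suc s + i) mod N = q \<longleftrightarrow> i = m \<or> i = N - 1" if "i < N" for i
    proof -
      have "(Suc s + i) mod N = (if Suc s + i < N then Suc s + i else Suc s + i - N)"
        using that s pq(1) qN by (cases "Suc s + i < N") (auto simp: le_mod_geq)
      then show ?thesis using that s pq(1) qN N by auto
    qed
    have "l (Suc s + 0) = r (Suc s + 0)"
    proof (rule welded_cycle_start[of "\<lambda>i. l (Suc s + i)" "\<lambda>i. r (Suc s + i)" N m m' k j, OF car _ _ _ _ N m])
      show "l (Suc s + Suc i) \<otimes>\<^bsub>knot_group ?D\<^esub> l (Suc s + i) = l (Suc s + i) \<otimes>\<^bsub>knot_group ?D\<^esub> r (Suc s + i) \<and>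
          r (Suc s + Suc i) = l (Suc s + i)" if "i < N" "i \<noteq> m" "i \<noteq> N - 1" for i
        using run[of "Suc s + i"] mod[OF that(1)] that by simp
      show "l (Suc s + Suc i) = r (Suc s + i) \<and> r (Suc s + Suc i) = l (Suc s + i)" if "i = m \<or> i = N - 1" for i
        using weld[of "Suc s + i"] mod[of i] that N by auto
    qed (simp_all only: l_def r_def mod_add_self2 add_0_right)
    then show ?thesis by simp
  qed
  have "\<exists>s. l (Suc s) = r (Suc s)"
  proof -
    define A B where "A = q - p - 1" and "B = 2 * n - q + p"
    have AB: "A + B + 2 = N" "Suc p + A = q" "Suc q + B = N + p"
      using pq by (auto simp: A_def B_def N_def)
    have bal': "A = Suc B \<or> B = Suc A" using bal by (simp add: A_def B_def)
    show ?thesis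
    \<comment> \<open>The run lengths differ by one, so exactly one is even; its position decides
      whether to start after \<open>p\<close> or after \<open>q\<close>.\<close>
    proof (cases "even A")
      case True
      then obtain k where k: "A = 2 * k" by blast
      have "\<exists>j. B = 2 * j + 1 \<and> (k = j \<or> k = Suc j)" using bal' k by presburger
      then obtain j where j: "B = 2 * j + 1" "k = j \<or> k = Suc j" by blast
      have "l (Suc p) = r (Suc p)"
        by (rule start[OF k j]) (use AB in simp_all)
      then show ?thesis ..
    next
      case False
      then obtain j where j: "A = 2 * j + 1" using oddE by blast
      have "\<exists>k. B = 2 * k \<and> (k = j \<or> k = Suc j)" using bal' j by presburger
      then obtain k where k: "B = 2 * k" "k = j \<or> k = Suc j" by blast
      have "l (Suc q) = r (Suc q)"
        by (rule start[OF k(1) j k(2)]) (use AB in simp_all)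
      then show ?thesis ..
    qed
  qed
  then obtain s where s: "l s = r s" by blast
  have const: "l (s + i) = l s \<and> r (s + i) = l s" for i
  proof (induction i)
    case (Suc i)
    show ?case
    proof (cases "(s + i) mod N = p \<or> (s + i) mod N = q")
      case True
      then show ?thesis using weld[OF True] Suc by simp
    next
      case False
      then have "l (Suc (s + i)) \<otimes>\<^bsub>knot_group ?D\<^esub> l s = l s \<otimes>\<^bsub>knot_group ?D\<^esub> l s" "r (Suc (s + i)) = l s"
        using run[of "s + i"] Suc by auto
      then show ?thesis using car by simp
    qed
  qed (simp add: s)
  have "meridian ?D e = l s" if "e \<in> edges ?D" for e
  proof -
    obtain i b where e: "e = (i, b)" "i < N" using \<open>e \<in> edges ?D\<close> by (cases e) (auto simp: edges)
    \<comment> \<open>Adding \<open>s\<close> full turns to \<open>i\<close> keeps the edge and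
      reaches an index at or beyond \<open>s\<close>.\<close>
    obtain t where t: "s \<le> s * N + i" "s * N + i = s + t"
      using le_iff_add[of s "s * N + i"] N0 by (auto intro: trans_le_add1)
    have "l (s * N + i) = l s" "r (s * N + i) = l s" using const[of t] t by simp_all
    then show ?thesis using e by (cases b) (simp_all add: l_def r_def)
  qed
  moreover have "?D \<noteq> []" by (simp add: braid_closure_def)
  ultimately show ?thesis by (rule knot_group_infinite_cyclic[rotated])
qed

text \<open>The difference of the colours of the two strands is constant along each run and changes its
  sign at the welded crossings, so that the two runs shift the colours in opposite directions.\<close>

lemma welded_torus_not_cyclic:
  assumes pq: "p < q" "q \<le> 2 * n"
    and Q: "odd Q" "Q > 1" "Q dvd 2 * int p - 2 * int q + 2 * int n + 1"
  shows "\<not> knot_group (braid_closure (welded_word n p q)) \<cong> integer_group"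
proof -
  define N where "N = 2 * n + 1"
  let ?D = "braid_closure (welded_word n p q)"
  \<comment> \<open>Starting from colours 0 and -1, the crossing rules force these values over the
    integers, with no reduction modulo \<open>Q\<close> below the closing level.\<close>
  define f where "f = (\<lambda>(i, b).
      if i \<le> p then int i - of_bool b
      else if i \<le> q then 2 * int p - int i + of_bool b
      else 2 * int p - 2 * int q + int i - of_bool b)"
  show ?thesis
  proof (rule fox_colouring_not_infinite_cyclic[of Q ?D f "(0, False)" "(0, True)"])
    fix c assume "c \<in> set ?D"
    then obtain i where i: "i < N" and c: "c = Crossing (if i = p \<or> i = q then Virtual else Positive)
        (i, False) (i, True) (Suc i mod N, False) (Suc i mod N, True)"
      using pq unfolding set_braid_closure by (auto simp: Let_def nth_welded_word N_def)
    show "fox_rule Q f c"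
    proof (cases "Suc i = N")
      case False
      then have "Suc i mod N = Suc i" using i by simp
      then show ?thesis using pq by (auto simp: c f_def)
    next
      \<comment> \<open>Continued to level \<open>N\<close>, the left colour would be the number
        that \<open>Q\<close> divides by assumption, so it matches colour 0 at level 0.\<close>
      case True
      then have "Suc i mod N = 0" "i = 2 * n" by (simp_all add: N_def)
      moreover have "Q dvd - (2 * int p - 2 * int q + 2 * int n + 1)" using Q(3) by (simp only: dvd_minus_iff)
      ultimately show ?thesis using pq Q(3) by (auto simp: c f_def algebra_simps)
    qed
  qed (use Q in \<open>auto simp: f_def edges_braid_closure\<close>)
qed

theorem proposition4p2:
  fixes n m1 m2 p q :: nat and D :: "(nat \<times> bool) diagram"
  assumes "n \<ge> 1" and "m1 \<le> n - 1" and "m2 = 2 * n - 1 - m1"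
    and "separates_into n p q m1 m2"
    and "D = weld p (weld q (torus_diagram n))"
  shows "(m1 = n - 1 \<longrightarrow> knot_group D \<cong> integer_group) \<and>
         (1 \<le> m1 \<and> m1 < n - 1 \<longrightarrow> \<not> knot_group D \<cong> integer_group)"
proof -
  note pq = separates_into_lengths[OF assms(4)]
  have D: "D = braid_closure (welded_word n p q)"
    using assms(5) weld_torus_diagram_eq pq by simp
  show ?thesis
    unfolding D
  proof (intro conjI impI)
    assume "m1 = n - 1"
    then have "m2 = Suc m1" using assms(1,3) by simp
    then have "q - p - 1 = Suc (2 * n - q + p) \<or> 2 * n - q + p = Suc (q - p - 1)"
      using pq(3) by metis
    then show "knot_group (braid_closure (welded_word n p q)) \<cong> integer_group"
      by (rule welded_torus_cyclic[OF pq(1,2)])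
  next
    assume m1: "1 \<le> m1 \<and> m1 < n - 1"
    \<comment> \<open>Odd because \<open>m1 + m2 = 2 * n - 1\<close>, and at least 3 because
      \<open>m1 < n - 1\<close>.\<close>
    define Q where "Q = int m2 - int m1"
    have "Q = 2 * int n - 1 - 2 * int m1" using m1 assms(3) unfolding Q_def by linarith
    then have "odd Q" "Q > 1" using m1 by auto
    \<comment> \<open>This number is the length of the wrapping run minus that of the run between
      \<open>p\<close> and \<open>q\<close>; the sign depends on which of them has length
      \<open>m1\<close>.\<close>
    moreover have "2 * int p - 2 * int q + 2 * int n + 1 = Q \<or> 2 * int p - 2 * int q + 2 * int n + 1 = - Q"
      using pq unfolding Q_def by linarith
    then have "Q dvd 2 * int p - 2 * int q + 2 * int n + 1" by auto
    ultimately show "\<not> knot_group (braid_closure (welded_word n p q)) \<cong> integer_group"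
      by (rule welded_torus_not_cyclic[OF pq(1,2)])
  qed
qed

end
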